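(* Let $(X,d,\mathfrak{m})$ be a complete, separable metric measure space with $\int_Xe^{-cd(x,y)^2}\,\mathfrak{m}(dy)<\infty$ for some (hence all) $x\in X$ and all $c>0$. Assume that $\mathfrak{m}\in\mathcal{P}^2(X)$ and that $(X,d,\mathfrak{m})$ satisfies $\mathrm{CD}^e(K,N)$ with $K>0$ and $N<0$. Then, for any $\mu\in\mathcal{P}^2(X)$ with $\mathrm{Ent}_{\mathfrak{m}}(\mu)<\infty$ satisfying $$\mathfrak{c}_{K/N}\big(W_2(\mu,\mathfrak{m})\big)+\frac{\mathfrak{s}_{K/N}(W_2(\mu,\mathfrak{m}))}{N}\sqrt{I_{\mathfrak{m}}(\mu)}>0,$$ we have $$KN\left\{\exp\left(\frac{2}{N}\mathrm{Ent}_{\mathfrak{m}}(\mu)\right)-1\right\}\le I_{\mathfrak{m}}(\mu).$$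
   Context: For $\kappa<0$ and $\theta\ge0$: $\mathfrak{s}_\kappa(\theta)=\frac{1}{\sqrt{-\kappa}}\sinh(\sqrt{-\kappa}\theta)$ and $\mathfrak{c}_\kappa(\theta)=\cosh(\sqrt{-\kappa}\theta)$ (here $\kappa=K/N<0$). For $t\in[0,1]$, $\sigma^{(t)}_\kappa(\theta)=\mathfrak{s}_\kappa(t\theta)/\mathfrak{s}_\kappa(\theta)$ for $\theta>0$, and $\sigma^{(t)}_\kappa(0)=t$. $\mathcal{P}^2(X)$ is the set of Borel probability measures on $X$ with finite second moment, equipped with the $L^2$-Wasserstein distance $W_2$. The relative entropy is $\mathrm{Ent}_{\mathfrak{m}}(\mu)=\int_X\rho\log\rho\,d\mathfrak{m}$ if $\mu=\rho\mathfrak{m}\ll\mathfrak{m}$ and $\int_{\{\rho>1\}}\rho\log\rho\,d\mathfrak{m}<\infty$, and $\mathrm{Ent}_{\mathfrak{m}}(\mu)=\infty$ otherwise. $(K,N)$-convexity for $K>0$, $N<0$: on a metric space $(Y,\delta)$, a function $f:Y\to(-\infty,\infty]$ with $f_N:=e^{-f/N}$ is $(K,N)$-convex if any $y_0,y_1$ with $f(y_0),f(y_1)<\infty$ admit a minimal geodesic $\gamma:[0,1]\to Y$ (i.e. $\delta(\gamma(s),\gamma(t))=|s-t|\delta(\gamma(0),\gamma(1))$) from $y_0$ to $y_1$ with $f_N(\gamma(t))\le\sigma^{(1-t)}_{K/N}(D)f_N(y_0)+\sigma^{(t)}_{K/N}(D)f_N(y_1)$ for all $t\in[0,1]$, where $D=\delta(y_0,y_1)$.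 The space $(X,d,\mathfrak{m})$ satisfies $\mathrm{CD}^e(K,N)$ if $\mathrm{Ent}_{\mathfrak{m}}$ is $(K,N)$-convex on $(\mathcal{P}^2(X),W_2)$. The Fisher information of $\mu$ with $\mathrm{Ent}_{\mathfrak{m}}(\mu)<\infty$ is $I_{\mathfrak{m}}(\mu)=|\nabla_-\mathrm{Ent}_{\mathfrak{m}}|(\mu)^2\in[0,\infty]$, where $|\nabla_-\mathrm{Ent}_{\mathfrak{m}}|(\mu)=\max\{\limsup_{\nu\to\mu}\frac{\mathrm{Ent}_{\mathfrak{m}}(\mu)-\mathrm{Ent}_{\mathfrak{m}}(\nu)}{W_2(\mu,\nu)},0\}$ (limit in $(\mathcal{P}^2(X),W_2)$). *)

theory Defs
  imports "HOL-Probability.Probability"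
begin

definition ereal_exp :: "ereal \<Rightarrow> ereal" where
  "ereal_exp x = (case x of ereal r \<Rightarrow> ereal (exp r) | PInfty \<Rightarrow> \<infinity> | MInfty \<Rightarrow> 0)"

text \<open>Only used on \<open>[0,\<infinity>]\<close>.\<close>
definition ereal_sqrt :: "ereal \<Rightarrow> ereal" where
  "ereal_sqrt x = (if x = \<infinity> then \<infinity> else ereal (sqrt (real_of_ereal x)))"

text \<open>For \<open>\<kappa> < 0\<close> and \<open>\<theta> \<ge> 0\<close>.\<close>
definition s_fun :: "real \<Rightarrow> real \<Rightarrow> real" where
  "s_fun \<kappa> \<theta> = sinh (sqrt (- \<kappa>) * \<theta>) / sqrt (- \<kappa>)"

definition c_fun :: "real \<Rightarrow> real \<Rightarrow> real" where
  "c_fun \<kappa> \<theta> = cosh (sqrt (- \<kappa>) * \<theta>)"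

definition sigma_fun :: "real \<Rightarrow> real \<Rightarrow> real \<Rightarrow> real" where
  "sigma_fun \<kappa> t \<theta> = (if \<theta> = 0 then t else s_fun \<kappa> (t * \<theta>) / s_fun \<kappa> \<theta>)"

text \<open>The metric space is given by a carrier set and a distance function, since the space of
  interest, the Wasserstein space, is a subset of the type of measures.\<close>

definition min_geodesic :: "'b set \<Rightarrow> ('b \<Rightarrow> 'b \<Rightarrow> real) \<Rightarrow> 'b \<Rightarrow> 'b \<Rightarrow> (real \<Rightarrow> 'b) \<Rightarrow> bool" where
  "min_geodesic Y \<delta> y0 y1 \<gamma> \<longleftrightarrow>
     \<gamma> ` {0..1} \<subseteq> Y \<and> \<gamma> 0 = y0 \<and> \<gamma> 1 = y1 \<and>
     (\<forall>s\<in>{0..1}. \<forall>t\<in>{0..1}. \<delta> (\<gamma> s) (\<gamma> t) = \<bar>s - t\<bar> * \<delta> (\<gamma> 0) (\<gamma> 1))"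

text \<open>\<open>f\<^sub>N = exp (- f / N)\<close>; for \<open>N < 0\<close> it is \<open>\<infinity>\<close> where \<open>f\<close> is.\<close>
definition exp_fun :: "real \<Rightarrow> ('b \<Rightarrow> ereal) \<Rightarrow> 'b \<Rightarrow> ereal" where
  "exp_fun N f y = ereal_exp (- f y / ereal N)"

text \<open>For \<open>K > 0\<close> and \<open>N < 0\<close>. The first conjunct expresses \<open>f : Y \<rightarrow> (-\<infinity>,\<infinity>]\<close>.\<close>
definition KN_convex ::
  "'b set \<Rightarrow> ('b \<Rightarrow> 'b \<Rightarrow> real) \<Rightarrow> real \<Rightarrow> real \<Rightarrow> ('b \<Rightarrow> ereal) \<Rightarrow> bool" where
  "KN_convex Y \<delta> K N f \<longleftrightarrow>
     (\<forall>y\<in>Y. f y \<noteq> -\<infinity>) \<and>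
     (\<forall>y0\<in>Y. \<forall>y1\<in>Y. f y0 < \<infinity> \<longrightarrow> f y1 < \<infinity> \<longrightarrow>
        (\<exists>\<gamma>. min_geodesic Y \<delta> y0 y1 \<gamma> \<and>
           (\<forall>t\<in>{0..1}.
              exp_fun N f (\<gamma> t)
                \<le> ereal (sigma_fun (K / N) (1 - t) (\<delta> y0 y1)) * exp_fun N f y0
                  + ereal (sigma_fun (K / N) t (\<delta> y0 y1)) * exp_fun N f y1)))"

text \<open>The filter \<open>z \<rightarrow> y\<close>, \<open>z \<noteq> y\<close>, in \<open>(Y,\<delta>)\<close>.\<close>
definition punctured_nhds :: "'b set \<Rightarrow> ('b \<Rightarrow> 'b \<Rightarrow> real) \<Rightarrow> 'b \<Rightarrow> 'b filter" where
  "punctured_nhds Y \<delta> y = (INF \<epsilon>\<in>{0<..}. principal {z \<in> Y. z \<noteq> y \<and> \<delta> y z < \<epsilon>})"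

definition descending_slope ::
  "'b set \<Rightarrow> ('b \<Rightarrow> 'b \<Rightarrow> real) \<Rightarrow> ('b \<Rightarrow> ereal) \<Rightarrow> 'b \<Rightarrow> ereal" where
  "descending_slope Y \<delta> f y =
     max (Limsup (punctured_nhds Y \<delta> y) (\<lambda>z. (f y - f z) / ereal (\<delta> y z))) 0"

definition P2 :: "'a::polish_space measure set" where
  "P2 = {\<mu>. prob_space \<mu> \<and> sets \<mu> = sets borel \<and>
            (\<exists>x. (\<integral>\<^sup>+ y. ennreal ((dist x y)\<^sup>2) \<partial>\<mu>) < \<infinity>)}"

definition couplings ::
  "'a::polish_space measure \<Rightarrow> 'a measure \<Rightarrow> ('a \<times> 'a) measure set" where
  "couplings \<mu> \<nu> = {\<pi>. prob_space \<pi> \<and> sets \<pi> = sets borel \<and>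
                        distr \<pi> borel fst = \<mu> \<and> distr \<pi> borel snd = \<nu>}"

text \<open>The infimum is finite on \<open>P2\<close>, where the conversion to \<open>real\<close> loses nothing.\<close>
definition W2 :: "'a::polish_space measure \<Rightarrow> 'a measure \<Rightarrow> real" where
  "W2 \<mu> \<nu> =
     sqrt (enn2real (INF \<pi>\<in>couplings \<mu> \<nu>. \<integral>\<^sup>+ p. ennreal ((dist (fst p) (snd p))\<^sup>2) \<partial>\<pi>))"

text \<open>For \<open>\<sigma>\<close>-finite \<open>m\<close> and finite \<open>\<mu>\<close>, where \<open>RN_deriv m \<mu>\<close> is \<open>m\<close>-a.e. finite.
  As \<open>ennreal\<close> truncates negative numbers to \<open>0\<close>, the two integrals in the first branch are those
  of the positive part (supported on \<open>{\<rho> > 1}\<close>, hence finite) and the negative part of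
  \<open>\<rho> ln \<rho>\<close>. Their difference is \<open>-\<infinity>\<close> if the latter is infinite.\<close>
definition Ent :: "'a::polish_space measure \<Rightarrow> 'a measure \<Rightarrow> ereal" where
  "Ent m \<mu> =
     (let \<rho> = (\<lambda>x. enn2real (RN_deriv m \<mu> x)) in
      if absolutely_continuous m \<mu> \<and>
         (\<integral>\<^sup>+ x\<in>{x. \<rho> x > 1}. ennreal (\<rho> x * ln (\<rho> x)) \<partial>m) < \<infinity>
      then enn2ereal (\<integral>\<^sup>+ x. ennreal (\<rho> x * ln (\<rho> x)) \<partial>m)
             - enn2ereal (\<integral>\<^sup>+ x. ennreal (- (\<rho> x * ln (\<rho> x))) \<partial>m)
      else \<infinity>)"

definition CDe :: "'a::polish_space measure \<Rightarrow> real \<Rightarrow> real \<Rightarrow> bool" where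
  "CDe m K N \<longleftrightarrow> KN_convex P2 W2 K N (Ent m)"

definition Fisher_information :: "'a::polish_space measure \<Rightarrow> 'a measure \<Rightarrow> ereal" where
  "Fisher_information m \<mu> = (descending_slope P2 W2 (Ent m) \<mu>)\<^sup>2"

end

theory Submission
  imports Defs
begin

text \<open>
  The inequality compares the value of a \<open>(K,N)\<close>-convex function at a point with its slope
  there, along a geodesic towards a point where the function vanishes; the latter is \<open>m\<close>,
  because \<open>Ent m m = 0\<close> (\<open>Ent_self\<close>).

  Let \<open>D = W2 \<mu> m > 0\<close> and follow the geodesic \<open>\<gamma>\<close> from \<open>\<mu>\<close> to \<open>m\<close> along which
  the entropy is convex. Taking \<open>- N ln\<close> of the convexity inequality gives an upper bound for
  \<open>Ent m (\<gamma> t)\<close> which is sharp at \<open>t = 0\<close> and differentiable there, so the descending slope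
  \<open>S\<close> at \<open>\<mu>\<close> is at least minus its derivative divided by \<open>D\<close>. With
  \<open>s = s_fun (K/N) D\<close>, \<open>c = c_fun (K/N) D\<close> and \<open>a = exp (Ent m \<mu> / N)\<close> this reads
  \<open>- N (c - a) / s \<le> S\<close> (\<open>KN_convex_slope_bound\<close>), that is, \<open>c + s S / N \<le> a\<close>.
  The positivity hypothesis says that the left-hand side is positive, so the inequality may be
  squared. Since \<open>c\<^sup>2 = 1 - (K/N) s\<^sup>2\<close>, the bound on \<open>K N (a\<^sup>2 - 1)\<close> that results is
  \<open>S\<^sup>2 - (c S - K s)\<^sup>2\<close>, and dropping the square yields the claim
  (\<open>square_deficit_le_square_slope\<close>).

  The case \<open>W2 \<mu> m = 0\<close> is decided by the sign of the entropy: either \<open>Ent m \<mu> \<le> 0\<close>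
  and the left-hand side of the claim is not positive, or the difference quotient at \<open>m\<close> is
  \<open>Ent m \<mu> / 0 = \<infinity>\<close> and so is the slope (\<open>descending_slope_eq_infinity\<close>).
\<close>

section \<open>Lower bounds for the descending slope\<close>

lemma filterlim_punctured_nhds_iff:
  "filterlim g (punctured_nhds Y \<delta> y) F \<longleftrightarrow>
     (\<forall>\<epsilon>>0. \<forall>\<^sub>F t in F. g t \<in> Y \<and> g t \<noteq> y \<and> \<delta> y (g t) < \<epsilon>)"
  unfolding punctured_nhds_def filterlim_INF by (auto simp: filterlim_principal)

lemma Limsup_compose_le:
  fixes h :: "'b \<Rightarrow> 'c::complete_lattice"
  assumes "filterlim g G F"
  shows "Limsup F (\<lambda>t. h (g t)) \<le> Limsup G h"
  unfolding Limsup_def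
proof (rule INF_greatest)
  fix P assume "P \<in> {P. eventually P G}"
  then have "(\<lambda>t. P (g t)) \<in> {P. eventually P F}"
    using eventually_compose_filterlim[OF _ assms] by simp
  then show "(INF P\<in>{P. eventually P F}. SUP t\<in>Collect P. h (g t)) \<le> Sup (h ` Collect P)"
    by (rule INF_lower2) (auto intro!: SUP_least SUP_upper)
qed

text \<open>
  Along \<open>\<gamma>\<close> the difference quotients of \<open>f\<close> dominate those of its majorant \<open>g\<close>, because
  the two agree at the base point; the limit superior over all approaches to \<open>y\<close> dominates the
  one along \<open>\<gamma>\<close>. As \<open>\<delta>\<close> is an arbitrary function, \<open>\<gamma> t \<noteq> y\<close> has to be demanded in
  addition to \<open>\<delta> y (\<gamma> t) = t * D\<close>.
\<close>
lemma descending_slope_ge_curve: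
  fixes f :: "'b \<Rightarrow> ereal" and g :: "real \<Rightarrow> real"
  assumes "D > 0"
    and curve: "\<And>t. 0 < t \<Longrightarrow> t \<le> 1 \<Longrightarrow> \<gamma> t \<in> Y \<and> \<gamma> t \<noteq> y \<and> \<delta> y (\<gamma> t) = t * D"
    and le: "\<And>t. 0 < t \<Longrightarrow> t \<le> 1 \<Longrightarrow> f (\<gamma> t) \<le> ereal (g t)"
    and fy: "f y = ereal (g 0)"
    and der: "(g has_real_derivative g') (at 0)"
  shows "ereal (- g' / D) \<le> descending_slope Y \<delta> f y"
proof -
  have ev1: "\<forall>\<^sub>F t in at_right (0::real). 0 < t \<and> t < e" if "e > 0" for e
    using that by (auto simp: eventually_at_right_field)
  have lim: "filterlim \<gamma> (punctured_nhds Y \<delta> y) (at_right 0)"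
    unfolding filterlim_punctured_nhds_iff
  proof (intro allI impI)
    fix \<epsilon> :: real assume "\<epsilon> > 0"
    then have "min 1 (\<epsilon> / D) > 0" using \<open>D > 0\<close> by simp
    from ev1[OF this] show "\<forall>\<^sub>F t in at_right 0. \<gamma> t \<in> Y \<and> \<gamma> t \<noteq> y \<and> \<delta> y (\<gamma> t) < \<epsilon>"
      by eventually_elim (use curve \<open>D > 0\<close> in \<open>auto simp: field_simps\<close>)
  qed
  have "((\<lambda>t. (g t - g 0) / (t - 0)) \<longlongrightarrow> g') (at_right 0)"
    using der unfolding has_field_derivative_iff by (rule filterlim_mono) (auto simp: at_le)
  then have "((\<lambda>t. - ((g t - g 0) / (t - 0)) / D) \<longlongrightarrow> - g' / D) (at_right 0)"
    using \<open>D > 0\<close> by (intro tendsto_intros) auto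
  moreover have "- ((g t - g 0) / (t - 0)) / D = (g 0 - g t) / (t * D)" for t
    using \<open>D > 0\<close> by (cases "t = 0") (auto simp: field_simps)
  ultimately have "((\<lambda>t. (g 0 - g t) / (t * D)) \<longlongrightarrow> - g' / D) (at_right 0)"
    by simp
  then have "Limsup (at_right 0) (\<lambda>t. ereal ((g 0 - g t) / (t * D))) = ereal (- g' / D)"
    by (intro lim_imp_Limsup) auto
  then have "ereal (- g' / D) = Limsup (at_right 0) (\<lambda>t. ereal ((g 0 - g t) / (t * D)))"
    by simp
  also have "\<dots> \<le> Limsup (at_right 0) (\<lambda>t. (f y - f (\<gamma> t)) / ereal (\<delta> y (\<gamma> t)))"
  proof (rule Limsup_mono)
    show "\<forall>\<^sub>F t in at_right 0.
        ereal ((g 0 - g t) / (t * D)) \<le> (f y - f (\<gamma> t)) / ereal (\<delta> y (\<gamma> t))"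
      using ev1[OF zero_less_one]
    proof eventually_elim
      case (elim t)
      then have t: "0 < t" "t \<le> 1" by auto
      have "ereal (g 0 - g t) \<le> f y - f (\<gamma> t)"
        using ereal_minus_mono[OF order_refl le[OF t], of "f y"] fy by simp
      then have "ereal (g 0 - g t) / ereal (t * D) \<le> (f y - f (\<gamma> t)) / ereal (t * D)"
        using t \<open>D > 0\<close> by (intro ereal_divide_right_mono) auto
      then show ?case using curve[OF t] t \<open>D > 0\<close> by simp
    qed
  qed
  also have "\<dots> \<le> Limsup (punctured_nhds Y \<delta> y) (\<lambda>z. (f y - f z) / ereal (\<delta> y z))"
    using lim by (rule Limsup_compose_le)
  finally show ?thesis
    unfolding descending_slope_def by (simp add: le_max_iff_disj)
qed

text \<open>
  Extended real division gives \<open>r / 0 = \<infinity>\<close> for \<open>r > 0\<close>, and a point at distance zero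
  from \<open>y\<close> but different from it belongs to every punctured neighbourhood of \<open>y\<close>.
\<close>
lemma descending_slope_eq_infinity:
  assumes "z \<in> Y" and "\<delta> y z = 0" and "f z < f y"
  shows "descending_slope Y \<delta> f y = \<infinity>"
proof -
  have pos: "f y - f z > 0" using assms(3) by (cases "f y"; cases "f z") auto
  have "\<infinity> = (f y - f z) / ereal (\<delta> y z)"
    using pos assms(2) by (simp add: divide_ereal_def)
  moreover have "\<dots> \<le> Limsup (punctured_nhds Y \<delta> y) (\<lambda>z. (f y - f z) / ereal (\<delta> y z))"
  proof -
    \<comment> \<open>The constant curve at \<open>z\<close>; the source filter only has to be nontrivial.\<close>
    have "filterlim (\<lambda>_. z) (punctured_nhds Y \<delta> y) (at_right (0::real))"
      unfolding filterlim_punctured_nhds_iff using assms by auto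
    from Limsup_compose_le[OF this, of "\<lambda>z. (f y - f z) / ereal (\<delta> y z)"]
    show ?thesis by (simp add: Limsup_const)
  qed
  ultimately show ?thesis unfolding descending_slope_def by simp
qed

section \<open>The distortion functions and the entropy transform\<close>

lemma exp_fun_le_iff:
  assumes "N < 0" and "F > 0"
  shows "exp_fun N f z \<le> ereal F \<longleftrightarrow> f z \<le> ereal (- N * ln F)"
proof (cases "f z")
  case (real r)
  have "exp (- r / N) \<le> F \<longleftrightarrow> - r / N \<le> ln F"
    using assms by (simp add: ln_ge_iff)
  also have "\<dots> \<longleftrightarrow> r \<le> - N * ln F"
    using assms by (auto simp: field_simps)
  finally show ?thesis using real \<open>N < 0\<close> by (simp add: exp_fun_def ereal_exp_def)
qed (use assms in \<open>auto simp: exp_fun_def ereal_exp_def divide_ereal_def\<close>)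

lemma s_fun_0: "s_fun \<kappa> 0 = 0"
  by (simp add: s_fun_def)

lemma s_fun_pos: "\<kappa> < 0 \<Longrightarrow> \<theta> > 0 \<Longrightarrow> s_fun \<kappa> \<theta> > 0"
  by (simp add: s_fun_def)

lemma s_fun_has_derivative:
  assumes "\<kappa> < 0"
  shows "(s_fun \<kappa> has_real_derivative c_fun \<kappa> \<theta>) (at \<theta>)"
proof -
  have "((\<lambda>\<theta>. sinh (r * \<theta>) / r) has_real_derivative cosh (r * \<theta>)) (at \<theta>)" if "r \<noteq> 0" for r
    using that by (auto intro!: derivative_eq_intros)
  from this[of "sqrt (- \<kappa>)"] show ?thesis
    using assms by (simp add: s_fun_def[abs_def] c_fun_def)
qed

lemma c_fun_square: "\<kappa> < 0 \<Longrightarrow> (c_fun \<kappa> \<theta>)\<^sup>2 = 1 - \<kappa> * (s_fun \<kappa> \<theta>)\<^sup>2"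
  unfolding s_fun_def c_fun_def by (simp add: cosh_square_eq power_divide)

section \<open>The slope of a \<open>(K,N)\<close>-convex function\<close>

text \<open>
  The convexity inequality bounds \<open>exp_fun N f\<close> along a geodesic by a real function \<open>F\<close>
  with \<open>F 0 = exp (- a / N)\<close>, so \<open>- N ln F\<close> is a majorant of \<open>f\<close> that is sharp at the
  start. The bound is minus its derivative at \<open>0\<close>, per unit of length.
\<close>
lemma KN_convex_slope_bound:
  fixes f :: "'b \<Rightarrow> ereal"
  assumes conv: "KN_convex Y \<delta> K N f" and "K > 0" and "N < 0"
    and "y0 \<in> Y" and "y1 \<in> Y" and D: "\<delta> y0 y1 > 0"
    and f0: "f y0 = ereal a" and f1: "f y1 = ereal b"
  defines "D \<equiv> \<delta> y0 y1"
  shows "ereal (- N * (c_fun (K/N) D - exp ((a - b) / N)) / s_fun (K/N) D)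
           \<le> descending_slope Y \<delta> f y0"
proof -
  define \<kappa> where "\<kappa> = K / N"
  have \<kappa>: "\<kappa> < 0" using assms(2,3) by (simp add: \<kappa>_def divide_pos_neg)
  have Dpos: "D > 0" using D by (simp add: D_def)
  define s where "s = s_fun \<kappa> D"
  have s: "s > 0" using s_fun_pos[OF \<kappa> Dpos] by (simp add: s_def)
  define F where "F t = s_fun \<kappa> ((1 - t) * D) / s * exp (- a / N)
                        + s_fun \<kappa> (t * D) / s * exp (- b / N)" for t
  obtain \<gamma> where geo: "min_geodesic Y \<delta> y0 y1 \<gamma>"
    and le: "\<And>t. t \<in> {0..1} \<Longrightarrow> exp_fun N f (\<gamma> t)
        \<le> ereal (sigma_fun \<kappa> (1 - t) D) * exp_fun N f y0
          + ereal (sigma_fun \<kappa> t D) * exp_fun N f y1"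
    using conv \<open>y0 \<in> Y\<close> \<open>y1 \<in> Y\<close> f0 f1 unfolding KN_convex_def D_def \<kappa>_def by force
  have F0: "F 0 = exp (- a / N)" using s by (simp add: F_def s_fun_0 flip: s_def)
  have F_pos: "F t > 0" if "0 < t" "t \<le> 1" for t
    unfolding F_def using s that Dpos \<kappa>
    by (intro add_nonneg_pos mult_pos_pos divide_pos_pos s_fun_pos mult_nonneg_nonneg
        divide_nonneg_pos) (auto simp: s_fun_def)
  have upper: "f (\<gamma> t) \<le> ereal (- N * ln (F t))" if "0 < t" "t \<le> 1" for t
  proof -
    have "exp_fun N f (\<gamma> t) \<le> ereal (F t)"
      using le[of t] that f0 f1 \<open>N < 0\<close> Dpos
      by (simp add: F_def sigma_fun_def s_def exp_fun_def ereal_exp_def)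
    then show ?thesis by (rule exp_fun_le_iff[OF \<open>N < 0\<close> F_pos[OF that], THEN iffD1])
  qed
  have curve: "\<gamma> t \<in> Y \<and> \<gamma> t \<noteq> y0 \<and> \<delta> y0 (\<gamma> t) = t * D" if "0 < t" "t \<le> 1" for t
  proof -
    have dist: "\<delta> (\<gamma> u) (\<gamma> v) = \<bar>u - v\<bar> * D" if "u \<in> {0..1}" "v \<in> {0..1}" for u v
      using geo that unfolding min_geodesic_def D_def by auto
    have \<gamma>0: "\<gamma> 0 = y0" using geo by (simp add: min_geodesic_def)
    \<comment> \<open>A geodesic has \<open>\<delta> y0 y0 = 0\<close> (both times equal to \<open>0\<close>), hence it leaves \<open>y0\<close>.\<close>
    have "\<delta> y0 y0 = 0" "\<delta> y0 (\<gamma> t) = t * D" using dist[of 0 0] dist[of 0 t] that \<gamma>0 by auto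
    moreover have "\<gamma> t \<in> Y" using geo that by (auto simp: min_geodesic_def)
    ultimately show ?thesis using that Dpos by auto
  qed
  have der_F: "(F has_real_derivative
      (D * exp (- b / N) - D * c_fun \<kappa> D * exp (- a / N)) / s) (at 0)"
  proof -
    have "((\<lambda>t. s_fun \<kappa> ((1 - t) * D)) has_real_derivative c_fun \<kappa> ((1 - 0) * D) * (- D)) (at 0)"
      "((\<lambda>t. s_fun \<kappa> (t * D)) has_real_derivative c_fun \<kappa> (0 * D) * D) (at 0)"
      by (rule DERIV_chain2[OF s_fun_has_derivative[OF \<kappa>]]; auto intro!: derivative_eq_intros)+
    then show ?thesis
      unfolding F_def using s
      by (auto intro!: derivative_eq_intros simp: c_fun_def field_simps)
  qed
  have "((\<lambda>t. - N * ln (F t)) has_real_derivative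
      - N * ((D * exp (- b / N) - D * c_fun \<kappa> D * exp (- a / N)) / s / F 0)) (at 0)"
    using DERIV_cmult[OF DERIV_chain2[OF DERIV_ln_divide der_F], of "- N"]
    by (simp add: F0 ac_simps)
  from descending_slope_ge_curve[where \<gamma> = \<gamma> and f = f and \<delta> = \<delta> and y = y0 and Y = Y
        and g = "\<lambda>t. - N * ln (F t)", OF Dpos curve upper _ this]
  have "ereal (- (- N * ((D * exp (- b / N) - D * c_fun \<kappa> D * exp (- a / N)) / s / F 0)) / D)
      \<le> descending_slope Y \<delta> f y0"
    using f0 F0 \<open>N < 0\<close> by simp
  moreover have "- (- N * ((D * exp (- b / N) - D * c_fun \<kappa> D * exp (- a / N)) / s / F 0)) / D
      = - N * (c_fun \<kappa> D - exp ((a - b) / N)) / s"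
  proof -
    have "exp ((a - b) / N) = exp (- b / N) / exp (- a / N)"
      by (simp add: exp_diff[symmetric] diff_divide_distrib)
    then show ?thesis using s Dpos by (simp add: F0 field_simps)
  qed
  ultimately show ?thesis by (simp add: s_def \<kappa>_def)
qed

text \<open>
  The slope bound says \<open>c + s S / N \<le> a\<close>. After squaring, the identity for \<open>c\<^sup>2\<close> makes the
  gap between the two sides of the claim the perfect square \<open>(c S - K s)\<^sup>2\<close>.
\<close>
lemma square_deficit_le_square_slope:
  fixes a c s S K N :: real
  assumes "K > 0" "N < 0" "s > 0"
    and c: "c\<^sup>2 = 1 - K / N * s\<^sup>2"
    and slope: "- N * (c - a) / s \<le> S"
    and pos: "c + s / N * S > 0"
  shows "K * N * (a\<^sup>2 - 1) \<le> S\<^sup>2"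
proof -
  have "c + s / N * S \<le> a"
    using slope \<open>s > 0\<close> \<open>N < 0\<close> by (simp add: field_simps)
  then have "(c + s / N * S)\<^sup>2 \<le> a\<^sup>2"
    using pos by (intro power_mono) auto
  then have "K * N * (a\<^sup>2 - 1) \<le> K * N * ((c + s / N * S)\<^sup>2 - 1)"
    using assms(1,2) by (intro mult_left_mono_neg) (auto simp: mult_pos_neg less_imp_le)
  also have "\<dots> = S\<^sup>2 - (c * S - K * s)\<^sup>2"
  proof -
    \<comment> \<open>Substituting \<open>s = u N\<close> removes all divisions and leaves a polynomial identity.\<close>
    define u where "u = s / N"
    have s: "s = u * N" using \<open>N < 0\<close> by (simp add: u_def)
    have c2: "c\<^sup>2 = 1 - K * N * u\<^sup>2"
      using c \<open>N < 0\<close> by (simp add: s power2_eq_square)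
    have "K * N * ((c + u * S)\<^sup>2 - 1) = S\<^sup>2 - (c * S - K * (u * N))\<^sup>2"
      using c2 by algebra
    then show ?thesis by (simp flip: s u_def)
  qed
  also have "\<dots> \<le> S\<^sup>2" by simp
  finally show ?thesis .
qed

section \<open>The inequality for the entropy\<close>

lemma Ent_self:
  assumes "prob_space m"
  shows "Ent m m = 0"
proof -
  interpret prob_space m by fact
  have "AE x in m. 1 = RN_deriv m m x"
    by (rule RN_deriv_unique) (simp_all add: density_1)
  then have AE1: "AE x in m. enn2real (RN_deriv m m x) = 1"
    by eventually_elim (metis enn2real_1)
  have i1: "(\<integral>\<^sup>+ x\<in>{x. enn2real (RN_deriv m m x) > 1}.
      ennreal (enn2real (RN_deriv m m x) * ln (enn2real (RN_deriv m m x))) \<partial>m) = (\<integral>\<^sup>+ x. 0 \<partial>m)"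
    by (rule nn_integral_cong_AE) (use AE1 in eventually_elim, simp)
  have i2: "(\<integral>\<^sup>+ x. ennreal (enn2real (RN_deriv m m x) * ln (enn2real (RN_deriv m m x))) \<partial>m)
      = (\<integral>\<^sup>+ x. 0 \<partial>m)"
    by (rule nn_integral_cong_AE) (use AE1 in eventually_elim, simp)
  have i3: "(\<integral>\<^sup>+ x. ennreal (- (enn2real (RN_deriv m m x) * ln (enn2real (RN_deriv m m x)))) \<partial>m)
      = (\<integral>\<^sup>+ x. 0 \<partial>m)"
    by (rule nn_integral_cong_AE) (use AE1 in eventually_elim, simp)
  show ?thesis
    unfolding Ent_def Let_def i1 i2 i3 by (simp add: absolutely_continuous_def)
qed

theorem corollary4p19:
  fixes m :: "'a::polish_space measure" and K N :: real
  assumes "sets m = sets borel"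
    and "\<exists>x. \<forall>c>0. (\<integral>\<^sup>+ y. ennreal (exp (- c * (dist x y)\<^sup>2)) \<partial>m) < \<infinity>"
    and "m \<in> P2"
    and "K > 0" and "N < 0"
    and "CDe m K N"
  shows "\<forall>\<mu>\<in>P2. Ent m \<mu> < \<infinity> \<longrightarrow>
           ereal (c_fun (K / N) (W2 \<mu> m))
             + ereal (s_fun (K / N) (W2 \<mu> m) / N) * ereal_sqrt (Fisher_information m \<mu>) > 0 \<longrightarrow>
           ereal (K * N) * (ereal_exp (ereal (2 / N) * Ent m \<mu>) - 1) \<le> Fisher_information m \<mu>"
proof (intro ballI impI)
  fix \<mu> :: "'a measure"
  assume "\<mu> \<in> P2" and finite: "Ent m \<mu> < \<infinity>"
    and pos: "ereal (c_fun (K / N) (W2 \<mu> m))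
             + ereal (s_fun (K / N) (W2 \<mu> m) / N) * ereal_sqrt (Fisher_information m \<mu>) > 0"
  have conv: "KN_convex P2 W2 K N (Ent m)" using assms(6) by (simp add: CDe_def)
  have Ent_m: "Ent m m = 0" using Ent_self \<open>m \<in> P2\<close> by (auto simp: P2_def)
  obtain e where e: "Ent m \<mu> = ereal e"
    using conv \<open>\<mu> \<in> P2\<close> finite unfolding KN_convex_def by (cases "Ent m \<mu>") auto
  define \<kappa> where "\<kappa> = K / N"
  have \<kappa>: "\<kappa> < 0" using \<open>K > 0\<close> \<open>N < 0\<close> by (simp add: \<kappa>_def divide_pos_neg)
  define a where "a = exp (e / N)"
  have "a\<^sup>2 = exp (2 / N * e)" by (simp add: a_def flip: exp_of_nat_mult)
  then have lhs: "ereal (K * N) * (ereal_exp (ereal (2 / N) * Ent m \<mu>) - 1)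
      = ereal (K * N * (a\<^sup>2 - 1))"
    by (simp add: e ereal_exp_def one_ereal_def)
  let ?S = "descending_slope P2 W2 (Ent m) \<mu>"
  have "?S \<ge> 0" by (simp add: descending_slope_def)
  then consider (inf) "?S = \<infinity>" | (fin) S where "?S = ereal S" "S \<ge> 0"
    by (cases ?S) auto
  then show "ereal (K * N) * (ereal_exp (ereal (2 / N) * Ent m \<mu>) - 1) \<le> Fisher_information m \<mu>"
  proof cases
    case inf
    then show ?thesis by (simp add: Fisher_information_def power2_eq_square)
  next
    case fin
    then have Fisher: "Fisher_information m \<mu> = ereal (S\<^sup>2)"
      by (simp add: Fisher_information_def)
    have "K * N * (a\<^sup>2 - 1) \<le> S\<^sup>2"
    proof (cases "W2 \<mu> m = 0")
      case True
      have "e \<le> 0"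
      proof (rule ccontr)
        assume "\<not> e \<le> 0"
        then have "Ent m m < Ent m \<mu>" by (simp add: e Ent_m)
        from descending_slope_eq_infinity[where f = "Ent m" and \<delta> = W2, OF \<open>m \<in> P2\<close> True this] fin(1)
        show False by simp
      qed
      then have "1 \<le> a" using \<open>N < 0\<close> by (simp add: a_def divide_nonpos_neg)
      then have "K * N * (a\<^sup>2 - 1) \<le> 0"
        using \<open>K > 0\<close> \<open>N < 0\<close> by (intro mult_nonpos_nonneg[of "K * N"]) (auto simp: mult_le_0_iff)
      also have "0 \<le> S\<^sup>2" by simp
      finally show ?thesis .
    next
      case False
      moreover have "W2 \<mu> m \<ge> 0" by (simp add: W2_def)
      ultimately have D: "W2 \<mu> m > 0" by linarith
      have Ent_m': "Ent m m = ereal 0" by (simp add: Ent_m)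
      show ?thesis
      proof (rule square_deficit_le_square_slope[OF \<open>K > 0\<close> \<open>N < 0\<close> s_fun_pos[OF \<kappa> D]])
        show "(c_fun \<kappa> (W2 \<mu> m))\<^sup>2 = 1 - K / N * (s_fun \<kappa> (W2 \<mu> m))\<^sup>2"
          using c_fun_square[OF \<kappa>] by (simp add: \<kappa>_def)
        show "- N * (c_fun \<kappa> (W2 \<mu> m) - a) / s_fun \<kappa> (W2 \<mu> m) \<le> S"
          using KN_convex_slope_bound[OF conv \<open>K > 0\<close> \<open>N < 0\<close> \<open>\<mu> \<in> P2\<close> \<open>m \<in> P2\<close> D e Ent_m']
            fin(1) by (simp add: a_def \<kappa>_def)
        show "c_fun \<kappa> (W2 \<mu> m) + s_fun \<kappa> (W2 \<mu> m) / N * S > 0"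
          using pos fin(2) by (simp add: Fisher ereal_sqrt_def \<kappa>_def)
      qed
    qed
    then show ?thesis by (simp add: lhs Fisher)
  qed
qed

end
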